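(* Let $\varphi$ be a formula (first-order, one free variable, in the language of groups). Then $\varphi$ is concise in the class of abelian groups; that is, for every abelian group $G$, if the set $G_\varphi$ is finite, then the subgroup $\varphi(G)=\langle G_\varphi\rangle$ is finite.
   Context: A formula means a first-order formula with exactly one free variable in the language of groups, without parameters. For a formula $\varphi$ and a group $G$, put $G_\varphi=\{g\in G\mid \varphi(g)\text{ is true in }G\}$ and let $\varphi(G)=\langle G_\varphi\rangle$ be the subgroup it generates. A formula $\varphi$ is concise in a class of groups $\mathcal C$ if for all $G\in\mathcal C$, $|G_\varphi|<\infty$ implies $|\varphi(G)|<\infty$. *)

theory Defs
  imports "HOL-Algebra.Algebra"
begin

datatype gterm =
    Var nat
  | One
  | Mult gterm gterm
  | Inv gterm

text \<open>The remaining connectives and the universal quantifier are definable from these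
  in the usual way.\<close>

datatype gformula =
    Eq gterm gterm
  | Neg gformula
  | Conj gformula gformula
  | Ex nat gformula

primrec term_vars :: "gterm \<Rightarrow> nat set" where
  "term_vars (Var x) = {x}"
| "term_vars One = {}"
| "term_vars (Mult s t) = term_vars s \<union> term_vars t"
| "term_vars (Inv t) = term_vars t"

primrec free_vars :: "gformula \<Rightarrow> nat set" where
  "free_vars (Eq s t) = term_vars s \<union> term_vars t"
| "free_vars (Neg \<phi>) = free_vars \<phi>"
| "free_vars (Conj \<phi> \<psi>) = free_vars \<phi> \<union> free_vars \<psi>"
| "free_vars (Ex x \<phi>) = free_vars \<phi> - {x}"

primrec term_val :: "('a, 'b) monoid_scheme \<Rightarrow> (nat \<Rightarrow> 'a) \<Rightarrow> gterm \<Rightarrow> 'a" where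
  "term_val G \<sigma> (Var x) = \<sigma> x"
| "term_val G \<sigma> One = \<one>\<^bsub>G\<^esub>"
| "term_val G \<sigma> (Mult s t) = term_val G \<sigma> s \<otimes>\<^bsub>G\<^esub> term_val G \<sigma> t"
| "term_val G \<sigma> (Inv t) = inv\<^bsub>G\<^esub> (term_val G \<sigma> t)"

primrec sat :: "('a, 'b) monoid_scheme \<Rightarrow> (nat \<Rightarrow> 'a) \<Rightarrow> gformula \<Rightarrow> bool" where
  "sat G \<sigma> (Eq s t) \<longleftrightarrow> term_val G \<sigma> s = term_val G \<sigma> t"
| "sat G \<sigma> (Neg \<phi>) \<longleftrightarrow> \<not> sat G \<sigma> \<phi>"
| "sat G \<sigma> (Conj \<phi> \<psi>) \<longleftrightarrow> sat G \<sigma> \<phi> \<and> sat G \<sigma> \<psi>"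
| "sat G \<sigma> (Ex x \<phi>) \<longleftrightarrow> (\<exists>a \<in> carrier G. sat G (\<sigma>(x := a)) \<phi>)"

definition one_free_var :: "gformula \<Rightarrow> bool" where
  "one_free_var \<phi> \<longleftrightarrow> (\<exists>x. free_vars \<phi> = {x})"

text \<open>Satisfaction depends only on the values of the free variables (lemma \<open>sat_cong\<close>
  below), so for a formula with exactly one free variable, whatever its name, the assignment
  that is constantly \<open>g\<close> expresses that the formula is true of \<open>g\<close> (lemma
  \<open>def_set_eq\<close>).\<close>

definition def_set :: "('a, 'b) monoid_scheme \<Rightarrow> gformula \<Rightarrow> 'a set" where
  "def_set G \<phi> = {g \<in> carrier G. sat G (\<lambda>_. g) \<phi>}"

definition def_subgroup :: "('a, 'b) monoid_scheme \<Rightarrow> gformula \<Rightarrow> 'a set" where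
  "def_subgroup G \<phi> = generate G (def_set G \<phi>)"

definition concise_in :: "gformula \<Rightarrow> ('a, 'b) monoid_scheme set \<Rightarrow> bool" where
  "concise_in \<phi> \<C> \<longleftrightarrow>
    (\<forall>G \<in> \<C>. finite (def_set G \<phi>) \<longrightarrow> finite (def_subgroup G \<phi>))"

lemma term_val_cong:
  "(\<And>x. x \<in> term_vars t \<Longrightarrow> \<sigma> x = \<tau> x) \<Longrightarrow> term_val G \<sigma> t = term_val G \<tau> t"
  by (induction t) auto

lemma sat_cong:
  "(\<And>x. x \<in> free_vars \<phi> \<Longrightarrow> \<sigma> x = \<tau> x) \<Longrightarrow> sat G \<sigma> \<phi> \<longleftrightarrow> sat G \<tau> \<phi>"
proof (induction \<phi> arbitrary: \<sigma> \<tau>)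
  case (Eq s t)
  then have "term_val G \<sigma> s = term_val G \<tau> s" "term_val G \<sigma> t = term_val G \<tau> t"
    by (auto intro!: term_val_cong)
  then show ?case by simp
next
  case (Neg \<phi>)
  have "sat G \<sigma> \<phi> \<longleftrightarrow> sat G \<tau> \<phi>"
    by (rule Neg.IH) (simp add: Neg.prems)
  then show ?case by simp
next
  case (Conj \<phi> \<psi>)
  have "sat G \<sigma> \<phi> \<longleftrightarrow> sat G \<tau> \<phi>"
    by (rule Conj.IH(1)) (simp add: Conj.prems)
  moreover have "sat G \<sigma> \<psi> \<longleftrightarrow> sat G \<tau> \<psi>"
    by (rule Conj.IH(2)) (simp add: Conj.prems)
  ultimately show ?case by simp
next
  case (Ex x \<phi>)
  have "sat G (\<sigma>(x := a)) \<phi> \<longleftrightarrow> sat G (\<tau>(x := a)) \<phi>" for a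
    by (rule Ex.IH) (auto simp: Ex.prems)
  then show ?case by simp
qed

lemma def_set_eq:
  assumes "free_vars \<phi> = {x}"
  shows "def_set G \<phi> = {g \<in> carrier G. sat G (\<sigma>(x := g)) \<phi>}"
proof -
  have "sat G (\<lambda>_. g) \<phi> \<longleftrightarrow> sat G (\<sigma>(x := g)) \<phi>" for g
    by (rule sat_cong) (simp add: assms)
  then show ?thesis by (simp add: def_set_def)
qed

end

theory Submission imports Defs begin

text \<open>Following Baur and Monk, the truth of a formula under an assignment \<open>\<sigma>\<close> in a fixed abelian
  group \<open>G\<close> depends only on which members of some finite family of subgroups of the group
  of all assignments contain \<open>\<sigma>\<close>: equations define subgroups, and quantifiers are eliminated by
  Neumann's lemma on coverings by cosets together with a counting argument. Restricted to constant
  assignments, this says that \<open>def_set G \<phi>\<close> is a Boolean combination of subgroups of \<open>G\<close>. If such a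
  set contains an element \<open>g\<close>, it contains \<open>g [^] (1 + m * k)\<close> for some \<open>m > 0\<close> and all \<open>k\<close>; so if
  it is finite, \<open>g\<close> has finite order, and finitely many torsion elements generate a finite abelian
  group.\<close>

section \<open>Counting finite unions through intersections\<close>

text \<open>Inclusion-exclusion: the size of a finite union is determined by the sizes of the
  intersections. The bounding sets vary in the induction, which also applies to
  \<open>U \<inter> A j\<close> and \<open>V \<inter> B j\<close>.\<close>

lemma card_Int_UN_transfer:
  assumes "finite F" "finite U" "finite V"
    and "\<And>J. J \<subseteq> F \<Longrightarrow> card (U \<inter> (\<Inter>i\<in>J. A i)) = card (V \<inter> (\<Inter>i\<in>J. B i))"
  shows "card (U \<inter> (\<Union>i\<in>F. A i)) = card (V \<inter> (\<Union>i\<in>F. B i))"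
  using assms
proof (induction F arbitrary: U V rule: finite_induct)
  case empty
  show ?case by simp
next
  case (insert j F)
  have split: "card (Z \<inter> (\<Union>i\<in>insert j F. C i)) + card (Z \<inter> C j \<inter> (\<Union>i\<in>F. C i))
      = card (Z \<inter> C j) + card (Z \<inter> (\<Union>i\<in>F. C i))" if "finite Z" for Z :: "'z set" and C
  proof -
    have *: "Z \<inter> (\<Union>i\<in>insert j F. C i) = (Z \<inter> C j) \<union> (Z \<inter> (\<Union>i\<in>F. C i))"
      "Z \<inter> C j \<inter> (\<Union>i\<in>F. C i) = (Z \<inter> C j) \<inter> (Z \<inter> (\<Union>i\<in>F. C i))" by auto
    show ?thesis unfolding * using that by (intro card_Un_Int [symmetric]) auto
  qed
  have "card (U \<inter> (\<Union>i\<in>F. A i)) = card (V \<inter> (\<Union>i\<in>F. B i))"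
    by (rule insert.IH) (auto intro!: insert.prems)
  moreover have "card (U \<inter> A j \<inter> (\<Union>i\<in>F. A i)) = card (V \<inter> B j \<inter> (\<Union>i\<in>F. B i))"
  proof (rule insert.IH)
    show "card (U \<inter> A j \<inter> (\<Inter>i\<in>J. A i)) = card (V \<inter> B j \<inter> (\<Inter>i\<in>J. B i))" if "J \<subseteq> F" for J
      using insert.prems(3)[of "insert j J"] that by (simp add: Int_assoc subset_insertI2 insert_mono)
  qed (simp_all add: insert.prems(1,2))
  moreover have "card (U \<inter> A j) = card (V \<inter> B j)"
    using insert.prems(3)[of "{j}"] by simp
  ultimately show ?case
    using split[OF insert.prems(1), of A] split[OF insert.prems(2), of B] by linarith
qed

section \<open>Right cosets and Neumann's lemma\<close>

context group
begin

lemma r_inv_cancel: "x \<in> carrier G \<Longrightarrow> y \<in> carrier G \<Longrightarrow> x \<otimes> (inv x \<otimes> y) = y"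
  by (simp flip: m_assoc)

lemma r_coset_eq_iff:
  assumes "subgroup H G" "x \<in> carrier G" "y \<in> carrier G"
  shows "H #> x = H #> y \<longleftrightarrow> x \<otimes> inv y \<in> H"
  by (metis assms is_group rcos_self repr_independence subgroup.rcos_module)

lemma r_coset_mem_iff:
  assumes "subgroup H G" "x \<in> carrier G" "y \<in> carrier G"
  shows "y \<in> H #> x \<longleftrightarrow> y \<otimes> inv x \<in> H"
  by (metis assms is_group subgroup.rcos_module)

text \<open>Induction on the number of subgroups: some coset of \<open>L\<close> avoids the given cosets of \<open>L\<close>,
  hence is covered by the cosets of the other subgroups, and so are all its translates.\<close>

lemma Neumann_infinite_index_cosets:
  assumes "finite \<L>" "subgroup K G"
    and "\<And>L. L \<in> \<L> \<Longrightarrow> subgroup L G" "\<And>L. L \<in> \<L> \<Longrightarrow> infinite ((\<lambda>x. L #> x) ` K)"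
    and "finite T" "T \<subseteq> carrier G"
  shows "\<not> K \<subseteq> (\<Union>L\<in>\<L>. \<Union>t\<in>T. L #> t)"
  using assms
proof (induction \<L> arbitrary: T rule: finite_induct)
  case empty
  show ?case using subgroup.one_closed[OF empty.prems(1)] by auto
next
  case (insert L \<L>)
  have K: "\<And>x. x \<in> K \<Longrightarrow> x \<in> carrier G" using insert.prems(1) subgroup.mem_carrier by metis
  have L: "subgroup L G" by (simp add: insert.prems(2))
  have T: "\<And>t. t \<in> T \<Longrightarrow> t \<in> carrier G" using insert.prems(5) by auto
  show ?case
  proof
    assume cover: "K \<subseteq> (\<Union>L\<in>insert L \<L>. \<Union>t\<in>T. L #> t)"
    \<comment> \<open>\<open>T\<close> supplies only finitely many cosets of \<open>L\<close>, so
      some \<open>L #> x\<close> with \<open>x \<in> K\<close> is missed.\<close>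
    have "infinite ((\<lambda>x. L #> x) ` K)" by (simp add: insert.prems(3))
    then have "\<not> (\<lambda>x. L #> x) ` K \<subseteq> (\<lambda>t. L #> t) ` T"
      using insert.prems(4) finite_subset by blast
    then obtain x where x: "x \<in> K" "\<And>t. t \<in> T \<Longrightarrow> L #> x \<noteq> L #> t" by blast
    \<comment> \<open>Distinct cosets of \<open>L\<close> are disjoint, so on
      \<open>K \<inter> (L #> x)\<close> the cover uses only members of \<open>\<L>\<close>.\<close>
    have xcov: "\<exists>M\<in>\<L>. \<exists>t\<in>T. y \<in> M #> t" if "y \<in> K" "y \<in> L #> x" for y
    proof -
      have "y \<notin> L #> t" if "t \<in> T" for t
        using x(2)[OF that] repr_independence[OF \<open>y \<in> L #> x\<close> K[OF x(1)] L]
          repr_independence[OF _ T[OF that] L, of y] by auto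
      then show ?thesis using cover that by blast
    qed
    \<comment> \<open>\<open>s t\<close> represents in \<open>K\<close> a coset
      \<open>L #> t\<close> that meets \<open>K\<close>. Right multiplication by
      \<open>inv x \<otimes> s t\<close> carries \<open>L #> x\<close> to \<open>L #> t\<close>;
      \<open>T'\<close> adds to \<open>T\<close> the representatives moved in this way.\<close>
    define s where "s t = (SOME s. s \<in> K \<inter> (L #> t))" for t
    define T' where "T' = T \<union>
      (\<lambda>(t, t'). t' \<otimes> inv x \<otimes> s t) ` ({t \<in> T. K \<inter> (L #> t) \<noteq> {}} \<times> T)"
    have s: "s t \<in> K \<and> s t \<in> L #> t" if "K \<inter> (L #> t) \<noteq> {}" for t
      using some_in_eq[of "K \<inter> (L #> t)"] that by (auto simp: s_def)
    have sc: "s t \<in> carrier G" if "K \<inter> (L #> t) \<noteq> {}" for t using s[OF that] K by blast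
    have "finite T'" using insert.prems(4) by (auto simp: T'_def)
    moreover have "T' \<subseteq> carrier G"
      using T sc K[OF x(1)] unfolding T'_def by fastforce
    moreover have "K \<subseteq> (\<Union>M\<in>\<L>. \<Union>t\<in>T'. M #> t)"
    proof
      fix y assume y: "y \<in> K"
      then obtain M t where M: "M \<in> insert L \<L>" "t \<in> T" "y \<in> M #> t" using cover by blast
      show "y \<in> (\<Union>M\<in>\<L>. \<Union>t\<in>T'. M #> t)"
      proof (cases "M = L")
        case False
        then show ?thesis using M by (auto simp: T'_def)
      next
        case True
        then have ne: "K \<inter> (L #> t) \<noteq> {}" using M y by auto
        note st = s[OF ne]
        have c: "s t \<in> carrier G" "y \<in> carrier G" "x \<in> carrier G" "t \<in> carrier G"
          using sc[OF ne] K[OF y] K[OF x(1)] T[OF M(2)] by simp_all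
        have "L #> y = L #> s t"
          using repr_independence[OF _ c(4) L] M(3) True st by simp
        then have "y \<otimes> inv s t \<in> L" using r_coset_eq_iff L c by blast
        \<comment> \<open>\<open>y\<close> is moved back into \<open>K \<inter> (L #> x)\<close>,
          where the reduced cover applies; the coset found there is then moved forward
          again.\<close>
        then have "y \<otimes> inv s t \<otimes> x \<in> L #> x"
          unfolding r_coset_def by blast
        moreover have "y \<otimes> inv s t \<otimes> x \<in> K"
          by (intro subgroup.m_closed[OF insert.prems(1)] subgroup.m_inv_closed[OF insert.prems(1)]
              y x conjunct1[OF st])
        ultimately obtain M' t' where M': "M' \<in> \<L>" "t' \<in> T" "y \<otimes> inv s t \<otimes> x \<in> M' #> t'"
          using xcov by blast
        have sM': "subgroup M' G" by (simp add: M' insert.prems(2))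
        have c': "t' \<in> carrier G" using M' T by auto
        have "y \<otimes> inv s t \<otimes> x \<otimes> inv t' \<in> M'"
          using M'(3) r_coset_mem_iff[OF sM'] c c' by simp
        then have "y \<in> M' #> (t' \<otimes> inv x \<otimes> s t)"
          using r_coset_mem_iff[OF sM'] c c' by (simp add: m_assoc inv_mult_group)
        moreover have "t' \<otimes> inv x \<otimes> s t \<in> T'"
          unfolding T'_def using M(2) M'(2) ne by (intro UnI2 image_eqI[of _ _ "(t, t')"]) simp_all
        ultimately show ?thesis using M'(1) by blast
      qed
    qed
    moreover have "\<not> K \<subseteq> (\<Union>M\<in>\<L>. \<Union>t\<in>T'. M #> t)"
      by (rule insert.IH) (simp_all add: insert.prems(1-3) \<open>finite T'\<close> \<open>T' \<subseteq> carrier G\<close>)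
    ultimately show False by blast
  qed
qed

end

section \<open>Partial cosets and the transfer of coset covers\<close>

text \<open>\<open>A\<close> is empty or a right coset of \<open>H\<close>.\<close>

definition partial_coset :: "('a, 'b) monoid_scheme \<Rightarrow> 'a set \<Rightarrow> 'a set \<Rightarrow> bool" where
  "partial_coset G H A \<longleftrightarrow> A \<subseteq> carrier G \<and>
    (\<forall>a\<in>A. \<forall>y\<in>carrier G. y \<in> A \<longleftrightarrow> y \<otimes>\<^bsub>G\<^esub> inv\<^bsub>G\<^esub> a \<in> H)"

lemma partial_coset_subset: "partial_coset G H A \<Longrightarrow> A \<subseteq> carrier G"
  by (simp add: partial_coset_def)

lemma partial_cosetD:
  "partial_coset G H A \<Longrightarrow> a \<in> A \<Longrightarrow> y \<in> carrier G \<Longrightarrow> y \<in> A \<longleftrightarrow> y \<otimes>\<^bsub>G\<^esub> inv\<^bsub>G\<^esub> a \<in> H"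
  by (simp add: partial_coset_def)

text \<open>The separate member \<open>A0\<close> keeps the intersection inside the carrier when
  \<open>J\<close> is empty and the indexed intersection is \<open>UNIV\<close>.\<close>

lemma partial_coset_Int_INT:
  assumes "partial_coset G H0 A0" "\<And>i. i \<in> J \<Longrightarrow> partial_coset G (H i) (A i)"
  shows "partial_coset G (H0 \<inter> (\<Inter>i\<in>J. H i)) (A0 \<inter> (\<Inter>i\<in>J. A i))"
  unfolding partial_coset_def
proof (intro conjI ballI)
  fix a y assume a: "a \<in> A0 \<inter> (\<Inter>i\<in>J. A i)" and y: "y \<in> carrier G"
  have "y \<in> A0 \<longleftrightarrow> y \<otimes>\<^bsub>G\<^esub> inv\<^bsub>G\<^esub> a \<in> H0"
    using a y by (intro partial_cosetD[OF assms(1)]) auto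
  moreover have "y \<in> A i \<longleftrightarrow> y \<otimes>\<^bsub>G\<^esub> inv\<^bsub>G\<^esub> a \<in> H i" if "i \<in> J" for i
    using a y that by (intro partial_cosetD[OF assms(2)]) auto
  ultimately show "y \<in> A0 \<inter> (\<Inter>i\<in>J. A i) \<longleftrightarrow> y \<otimes>\<^bsub>G\<^esub> inv\<^bsub>G\<^esub> a \<in> H0 \<inter> (\<Inter>i\<in>J. H i)"
    by simp
qed (use partial_coset_subset[OF assms(1)] in blast)

context group
begin

lemma subgroup_Int_INT:
  assumes "subgroup H0 G" "\<And>i. i \<in> J \<Longrightarrow> subgroup (H i) G"
  shows "subgroup (H0 \<inter> (\<Inter>i\<in>J. H i)) G"
proof -
  have "subgroup (\<Inter>(insert H0 (H ` J))) G"
    by (rule subgroups_Inter) (auto simp: assms)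
  then show ?thesis by simp
qed

text \<open>Two nonempty partial cosets of the same \<open>M\<close> differ by a right translation,
  and right translations permute the right cosets of \<open>K\<close>.\<close>

lemma card_r_cosets_partial_coset:
  assumes K: "subgroup K G" and U: "partial_coset G M U" and V: "partial_coset G M V"
    and ne: "U = {} \<longleftrightarrow> V = {}"
  shows "card ((\<lambda>x. K #> x) ` U) = card ((\<lambda>x. K #> x) ` V)"
proof (cases "U = {}")
  case True
  then show ?thesis using ne by simp
next
  case False
  then obtain a b where a: "a \<in> U" and b: "b \<in> V" using ne by blast
  have ab: "a \<in> carrier G" "b \<in> carrier G"
    using a b partial_coset_subset[OF U] partial_coset_subset[OF V] by auto
  have Uc: "\<And>x. x \<in> U \<Longrightarrow> x \<in> carrier G" using partial_coset_subset[OF U] by auto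
  have Vc: "\<And>x. x \<in> V \<Longrightarrow> x \<in> carrier G" using partial_coset_subset[OF V] by auto
  have Kc: "K \<subseteq> carrier G" using K subgroup.subset by blast
  \<comment> \<open>Translation by \<open>t\<close> carries the chosen point \<open>a\<close> of
    \<open>U\<close> to the point \<open>b\<close> of \<open>V\<close>.\<close>
  define t where "t = inv a \<otimes> b"
  have t: "t \<in> carrier G" using ab by (simp add: t_def)
  have V_eq: "V = (\<lambda>x. x \<otimes> t) ` U"
  proof (intro equalityI subsetI)
    fix y assume y: "y \<in> V"
    have "y \<otimes> inv b \<in> M" using partial_cosetD[OF V b] y Vc by blast
    then have "y \<otimes> inv b \<otimes> a \<otimes> inv a \<in> M" using y Vc ab by (simp add: m_assoc)
    then have "y \<otimes> inv b \<otimes> a \<in> U" using partial_cosetD[OF U a] y Vc ab by simp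
    moreover have "y = y \<otimes> inv b \<otimes> a \<otimes> t"
      using y Vc ab by (simp add: t_def m_assoc r_inv_cancel)
    ultimately show "y \<in> (\<lambda>x. x \<otimes> t) ` U" by blast
  next
    fix y assume "y \<in> (\<lambda>x. x \<otimes> t) ` U"
    then obtain x where x: "x \<in> U" "y = x \<otimes> t" by blast
    have "x \<otimes> inv a \<in> M" using partial_cosetD[OF U a] x Uc by blast
    then have "y \<otimes> inv b \<in> M" using x Uc ab by (simp add: t_def m_assoc)
    then show "y \<in> V" using partial_cosetD[OF V b] x Uc t by simp
  qed
  have img: "(\<lambda>x. K #> x) ` V = (\<lambda>C. C #> t) ` (\<lambda>x. K #> x) ` U"
    unfolding V_eq image_image
    by (rule image_cong) (use coset_mult_assoc Kc t Uc in auto)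
  have "inj_on (\<lambda>C. C #> t) ((\<lambda>x. K #> x) ` U)"
  proof (rule inj_onI, clarsimp)
    fix x y assume xy: "x \<in> U" "y \<in> U" "K #> x #> t = K #> y #> t"
    have c: "x \<in> carrier G" "y \<in> carrier G" using xy Uc by auto
    have "K #> (x \<otimes> t) = K #> (y \<otimes> t)" using xy c t Kc by (simp add: coset_mult_assoc)
    then have "x \<otimes> t \<otimes> inv (y \<otimes> t) \<in> K" using r_coset_eq_iff K c t by simp
    moreover have "x \<otimes> t \<otimes> inv (y \<otimes> t) = x \<otimes> inv y"
      using c t by (simp add: m_assoc inv_mult_group r_inv_cancel)
    ultimately show "K #> x = K #> y" using r_coset_eq_iff K c by simp
  qed
  then show ?thesis unfolding img by (simp add: card_image)
qed

text \<open>For \<open>x\<close> in \<open>H0\<close> the coset of the intersection is determined by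
  the tuple of cosets \<open>H i #> x\<close>, and only finitely many tuples occur. Counting the
  cosets of \<open>H i\<close> that meet \<open>H0\<close> gives the index of
  \<open>H0 \<inter> H i\<close> in \<open>H0\<close>.\<close>

lemma finite_index_Int_INT:
  assumes "finite F" "subgroup H0 G" "\<And>i. i \<in> F \<Longrightarrow> subgroup (H i) G"
    and "\<And>i. i \<in> F \<Longrightarrow> finite ((\<lambda>x. H i #> x) ` H0)"
  shows "finite ((\<lambda>x. (H0 \<inter> (\<Inter>i\<in>F. H i)) #> x) ` H0)"
proof -
  let ?K = "H0 \<inter> (\<Inter>i\<in>F. H i)"
  have K: "subgroup ?K G" by (rule subgroup_Int_INT) (simp_all add: assms)
  have H0c: "\<And>x. x \<in> H0 \<Longrightarrow> x \<in> carrier G" using assms(2) subgroup.mem_carrier by metis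
  \<comment> \<open>Restriction to \<open>F\<close> makes the tuples extensional, hence members of a
    finite product.\<close>
  define f where "f x = (\<lambda>i\<in>F. H i #> x)" for x
  have "f ` H0 \<subseteq> (\<Pi>\<^sub>E i\<in>F. (\<lambda>x. H i #> x) ` H0)" by (auto simp: f_def)
  then have fin: "finite (f ` H0)" by (rule finite_subset) (simp add: finite_PiE assms)
  have key: "?K #> x = ?K #> y" if "x \<in> H0" "y \<in> H0" "f x = f y" for x y
  proof -
    have "x \<otimes> inv y \<in> H0"
      using that assms(2) by (meson subgroup.m_closed subgroup.m_inv_closed)
    moreover have "x \<otimes> inv y \<in> H i" if "i \<in> F" for i
    proof -
      have "H i #> x = H i #> y" using \<open>f x = f y\<close> \<open>i \<in> F\<close> by (metis f_def restrict_apply')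
      then show ?thesis using r_coset_eq_iff assms(3) H0c \<open>x \<in> H0\<close> \<open>y \<in> H0\<close> that by blast
    qed
    ultimately show ?thesis using r_coset_eq_iff[OF K] H0c that by blast
  qed
  have "(\<lambda>x. ?K #> x) ` H0 \<subseteq> (\<lambda>c. ?K #> (inv_into H0 f c)) ` f ` H0"
  proof
    fix C assume "C \<in> (\<lambda>x. ?K #> x) ` H0"
    then obtain x where x: "x \<in> H0" "C = ?K #> x" by blast
    have "?K #> x = ?K #> (inv_into H0 f (f x))"
      by (rule key) (use x in \<open>auto simp: inv_into_into f_inv_into_f\<close>)
    then show "C \<in> (\<lambda>c. ?K #> (inv_into H0 f c)) ` f ` H0" using x by blast
  qed
  then show ?thesis using fin finite_subset by blast
qed

text \<open>If \<open>K\<close> met only finitely many cosets of \<open>L\<close>, their translates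
  by finitely many coset representatives of \<open>K\<close> in \<open>H0\<close> would exhaust the
  cosets of \<open>L\<close> meeting \<open>H0\<close>.\<close>

lemma infinite_index_finite_index_subgroup:
  assumes K: "subgroup K G" and H0: "subgroup H0 G" and L: "subgroup L G" and "K \<subseteq> H0"
    and fin: "finite ((\<lambda>x. K #> x) ` H0)" and inf: "infinite ((\<lambda>x. L #> x) ` H0)"
  shows "infinite ((\<lambda>x. L #> x) ` K)"
proof
  assume finK: "finite ((\<lambda>x. L #> x) ` K)"
  have H0c: "\<And>x. x \<in> H0 \<Longrightarrow> x \<in> carrier G" using H0 subgroup.mem_carrier by metis
  obtain R where R: "R \<subseteq> H0" "finite R" "(\<lambda>x. K #> x) ` H0 = (\<lambda>x. K #> x) ` R"
    using finite_subset_image[OF fin subset_refl] by blast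
  have "(\<lambda>x. L #> x) ` H0 \<subseteq> (\<lambda>(C, r). C #> r) ` ((\<lambda>x. L #> x) ` K \<times> R)"
  proof
    fix C assume "C \<in> (\<lambda>x. L #> x) ` H0"
    then obtain x where x: "x \<in> H0" "C = L #> x" by blast
    then obtain r where r: "r \<in> R" "K #> x = K #> r" using R(3) by blast
    have c: "x \<in> carrier G" "r \<in> carrier G" using x r R H0c by auto
    have "x \<otimes> inv r \<in> K" using r r_coset_eq_iff[OF K] c by blast
    moreover have "C = L #> (x \<otimes> inv r) #> r"
      using x c subgroup.subset[OF L] by (simp add: coset_mult_assoc m_assoc)
    ultimately show "C \<in> (\<lambda>(C, r). C #> r) ` ((\<lambda>x. L #> x) ` K \<times> R)" using r by force
  qed
  then have "finite ((\<lambda>x. L #> x) ` H0)"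
    by (rule finite_subset) (use finK R in auto)
  with inf show False ..
qed

text \<open>The combinatorial core of Baur--Monk quantifier elimination. By Neumann's lemma the pieces
  of infinite index can be dropped from the cover; the remaining ones are unions of cosets of one
  subgroup \<open>K\<close> of finite index, and the number of these cosets in any intersection depends
  only on whether the intersection is empty.\<close>

lemma coset_cover_transfer:
  assumes F: "finite F" and H0: "subgroup H0 G" and H: "\<And>i. i \<in> F \<Longrightarrow> subgroup (H i) G"
    and A0: "partial_coset G H0 A0" and A: "\<And>i. i \<in> F \<Longrightarrow> partial_coset G (H i) (A i)"
    and B0: "partial_coset G H0 B0" and B: "\<And>i. i \<in> F \<Longrightarrow> partial_coset G (H i) (B i)"
    and pattern: "\<And>J. J \<subseteq> F \<Longrightarrow> A0 \<inter> (\<Inter>i\<in>J. A i) = {} \<longleftrightarrow> B0 \<inter> (\<Inter>i\<in>J. B i) = {}"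
    and cover: "A0 \<subseteq> (\<Union>i\<in>F. A i)"
  shows "B0 \<subseteq> (\<Union>i\<in>F. B i)"
proof -
  \<comment> \<open>\<open>F1\<close> singles out the pieces of finite index relative to
    \<open>H0\<close>, so \<open>K\<close> still has finite index in \<open>H0\<close>;
    \<open>q\<close> passes to cosets of \<open>K\<close>.\<close>
  define F1 where "F1 = {i \<in> F. finite ((\<lambda>x. H i #> x) ` H0)}"
  define K where "K = H0 \<inter> (\<Inter>i\<in>F1. H i)"
  define q where "q x = K #> x" for x
  have F1: "F1 \<subseteq> F" "finite F1" using F by (auto simp: F1_def)
  have K: "subgroup K G" unfolding K_def by (rule subgroup_Int_INT[OF H0 H]) (use F1 in blast)
  have Kc: "\<And>x. x \<in> K \<Longrightarrow> x \<in> carrier G" using K subgroup.mem_carrier by metis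
  have finK: "finite (q ` H0)"
    unfolding q_def K_def by (rule finite_index_Int_INT[OF F1(2) H0 H]) (auto simp: F1_def)
  have A0c: "\<And>x. x \<in> A0 \<Longrightarrow> x \<in> carrier G" using partial_coset_subset[OF A0] by auto
  have B0c: "\<And>x. x \<in> B0 \<Longrightarrow> x \<in> carrier G" using partial_coset_subset[OF B0] by auto

  have coverA: "A0 \<subseteq> (\<Union>i\<in>F1. A i)"
  proof (rule ccontr)
    \<comment> \<open>If \<open>a\<close> in \<open>A0\<close> avoided all pieces from
      \<open>F1\<close>, so would all of \<open>K #> a\<close>; translating by \<open>inv a\<close>
      would then cover \<open>K\<close> by cosets of subgroups of infinite index.\<close>
    assume "\<not> A0 \<subseteq> (\<Union>i\<in>F1. A i)"
    then obtain a where a: "a \<in> A0" "\<And>i. i \<in> F1 \<Longrightarrow> a \<notin> A i" by blast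
    have ac: "a \<in> carrier G" using a A0c by blast
    let ?L = "H ` (F - F1)"
    define T where "T = (\<lambda>i. (SOME t. t \<in> A i) \<otimes> inv a) ` {i \<in> F. A i \<noteq> {}}"
    have some: "(SOME t. t \<in> A i) \<in> A i" if "A i \<noteq> {}" for i using that some_in_eq by blast
    have somec: "(SOME t. t \<in> A i) \<in> carrier G" if "A i \<noteq> {}" "i \<in> F" for i
      using some[OF that(1)] partial_coset_subset[OF A[OF that(2)]] by blast
    have "K \<subseteq> (\<Union>L\<in>?L. \<Union>t\<in>T. L #> t)"
    proof
      fix k assume k: "k \<in> K"
      have kc: "k \<in> carrier G" "k \<otimes> a \<in> carrier G" using k Kc ac by auto
      have kaa: "k \<otimes> a \<otimes> inv a = k" using kc ac by (simp add: m_assoc)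
      have "k \<otimes> a \<in> A0"
        using partial_cosetD[OF A0 a(1) kc(2)] k kaa by (simp add: K_def)
      then obtain i where i: "i \<in> F" "k \<otimes> a \<in> A i" using cover by blast
      \<comment> \<open>For \<open>i\<close> in \<open>F1\<close>, membership in \<open>A i\<close>
        would pass from \<open>k \<otimes> a\<close> to \<open>a\<close>, because
        \<open>inv k\<close> lies in \<open>H i\<close>.\<close>
      have "i \<notin> F1"
      proof
        assume i1: "i \<in> F1"
        have "a \<otimes> inv (k \<otimes> a) = inv k"
          using kc ac by (simp add: inv_mult_group r_inv_cancel)
        moreover have "inv k \<in> H i"
          using k i1 subgroup.m_inv_closed[OF H[OF i(1)]] by (simp add: K_def)
        ultimately show False using partial_cosetD[OF A[OF i(1)] i(2) ac] a(2)[OF i1] by simp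
      qed
      have ne: "A i \<noteq> {}" using i by auto
      let ?t = "SOME t. t \<in> A i"
      have "k \<otimes> a \<otimes> inv ?t \<in> H i"
        using partial_cosetD[OF A[OF i(1)] some[OF ne] kc(2)] i by simp
      then have "k \<otimes> inv (?t \<otimes> inv a) \<in> H i"
        using kc ac somec[OF ne i(1)] by (simp add: inv_mult_group m_assoc)
      then have "k \<in> H i #> (?t \<otimes> inv a)"
        using r_coset_mem_iff[OF H[OF i(1)]] kc ac somec[OF ne i(1)] by simp
      then show "k \<in> (\<Union>L\<in>?L. \<Union>t\<in>T. L #> t)"
        using i ne \<open>i \<notin> F1\<close> by (auto simp: T_def)
    qed
    moreover have "\<not> K \<subseteq> (\<Union>L\<in>?L. \<Union>t\<in>T. L #> t)"
    proof (rule Neumann_infinite_index_cosets)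
      fix L assume "L \<in> ?L"
      then obtain i where i: "i \<in> F" "i \<notin> F1" "L = H i" by blast
      show L: "subgroup L G" using i H by simp
      show "infinite ((\<lambda>x. L #> x) ` K)"
      proof (rule infinite_index_finite_index_subgroup[OF K H0 L])
        show "K \<subseteq> H0" by (auto simp: K_def)
        show "finite ((\<lambda>x. K #> x) ` H0)" using finK by (simp add: q_def)
        show "infinite ((\<lambda>x. L #> x) ` H0)" using i by (simp add: F1_def)
      qed
    next
      show "finite ?L" "finite T" using F by (simp_all add: T_def)
      show "T \<subseteq> carrier G" using somec ac unfolding T_def by blast
    qed (rule K)
    ultimately show False by blast
  qed

  \<comment> \<open>Right translation by an element of \<open>C\<close> reduces this to the finitely
    many cosets of \<open>K\<close> in \<open>H0\<close>.\<close>
  have fin_q: "finite (q ` C)" if C: "partial_coset G H0 C" for C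
  proof (cases "C = {}")
    case False
    then obtain c where c: "c \<in> C" by blast
    have cc: "\<And>x. x \<in> C \<Longrightarrow> x \<in> carrier G" using partial_coset_subset[OF C] by auto
    have "q ` C \<subseteq> (\<lambda>D. D #> c) ` q ` H0"
    proof
      fix D assume "D \<in> q ` C"
      then obtain x where x: "x \<in> C" "D = q x" by blast
      then have "x \<otimes> inv c \<in> H0" using partial_cosetD[OF C c] cc by blast
      moreover have "D = q (x \<otimes> inv c) #> c"
        using x c cc subgroup.subset[OF K] by (simp add: q_def coset_mult_assoc m_assoc)
      ultimately show "D \<in> (\<lambda>D. D #> c) ` q ` H0" by blast
    qed
    then show ?thesis using finK finite_subset by blast
  qed simp

  \<comment> \<open>A partial coset of \<open>M \<supseteq> K\<close> is a union of cosets of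
    \<open>K\<close>; this makes \<open>q\<close> commute with the intersections below.\<close>
  have saturated: "y \<in> C" if "x \<in> C" "y \<in> carrier G" "q x = q y" "partial_coset G M C" "K \<subseteq> M"
    for x y C M
  proof -
    have "x \<in> carrier G" using that partial_coset_subset by blast
    then have "y \<otimes> inv x \<in> K" using r_coset_eq_iff[OF K] that by (metis q_def)
    then show ?thesis using partial_cosetD[OF that(4,1,2)] that(5) by blast
  qed
  have KH: "K \<subseteq> H i" if "i \<in> F1" for i using that by (auto simp: K_def)

  have q_Int: "q ` C0 \<inter> (\<Inter>i\<in>J. q ` C i) = q ` (C0 \<inter> (\<Inter>i\<in>J. C i))"
    if "J \<subseteq> F1" "partial_coset G H0 C0" "\<And>i. i \<in> F \<Longrightarrow> partial_coset G (H i) (C i)" for J C0 C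
  proof (intro equalityI subsetI)
    fix D assume D: "D \<in> q ` C0 \<inter> (\<Inter>i\<in>J. q ` C i)"
    then obtain x where x: "x \<in> C0" "D = q x" by blast
    have xc: "x \<in> carrier G" using x partial_coset_subset[OF that(2)] by blast
    have "x \<in> C i" if "i \<in> J" for i
    proof -
      obtain y where "y \<in> C i" "q y = q x" using D x \<open>i \<in> J\<close> by (auto simp: image_iff)
      then show ?thesis
        using saturated xc KH \<open>J \<subseteq> F1\<close> F1 \<open>i \<in> J\<close>
          \<open>\<And>i. i \<in> F \<Longrightarrow> partial_coset G (H i) (C i)\<close> by blast
    qed
    then show "D \<in> q ` (C0 \<inter> (\<Inter>i\<in>J. C i))" using x by blast
  qed auto

  \<comment> \<open>Corresponding intersections are partial cosets of one subgroup and, by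
    \<open>pattern\<close>, are empty together, so they contain equally many cosets of
    \<open>K\<close>. Inclusion-exclusion carries this over to unions.\<close>
  have count: "card (q ` A0 \<inter> (\<Union>i\<in>F1. q ` A i)) = card (q ` B0 \<inter> (\<Union>i\<in>F1. q ` B i))"
  proof (rule card_Int_UN_transfer)
    show "card (q ` A0 \<inter> (\<Inter>i\<in>J. q ` A i)) = card (q ` B0 \<inter> (\<Inter>i\<in>J. q ` B i))"
      if J: "J \<subseteq> F1" for J
    proof -
      have JF: "J \<subseteq> F" using J F1 by auto
      show ?thesis
        unfolding q_Int[where C = A, OF J A0 A, simplified] q_Int[where C = B, OF J B0 B, simplified] q_def
      proof (rule card_r_cosets_partial_coset[OF K])
        show "partial_coset G (H0 \<inter> (\<Inter>i\<in>J. H i)) (A0 \<inter> (\<Inter>i\<in>J. A i))"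
          by (rule partial_coset_Int_INT[OF A0 A]) (use JF in blast)
        show "partial_coset G (H0 \<inter> (\<Inter>i\<in>J. H i)) (B0 \<inter> (\<Inter>i\<in>J. B i))"
          by (rule partial_coset_Int_INT[OF B0 B]) (use JF in blast)
      qed (rule pattern[OF JF])
    qed
  qed (simp_all add: F1 fin_q[OF A0] fin_q[OF B0])
  have "card (q ` A0) = card (q ` B0)"
    unfolding q_def
    by (rule card_r_cosets_partial_coset[OF K A0 B0]) (use pattern[of "{}"] in simp)
  \<comment> \<open>The pieces from \<open>F1\<close> fill all cosets of \<open>K\<close> in
    \<open>A0\<close>; as the finite counts agree, they fill those in \<open>B0\<close> too.\<close>
  moreover have "q ` A0 \<inter> (\<Union>i\<in>F1. q ` A i) = q ` A0" using coverA by blast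
  ultimately have "card (q ` B0 \<inter> (\<Union>i\<in>F1. q ` B i)) = card (q ` B0)" using count by simp
  then have "q ` B0 \<inter> (\<Union>i\<in>F1. q ` B i) = q ` B0"
    by (intro card_subset_eq fin_q B0) auto
  then have qB: "q ` B0 \<subseteq> (\<Union>i\<in>F1. q ` B i)" by blast
  show ?thesis
  proof
    fix b assume b: "b \<in> B0"
    then obtain i where "i \<in> F1" "q b \<in> q ` B i" using qB by blast
    then obtain y where i: "i \<in> F1" "y \<in> B i" "q y = q b" by (metis imageE)
    then have "b \<in> B i" using saturated[OF i(2) B0c[OF b] i(3) B KH] F1 by blast
    then show "b \<in> (\<Union>i\<in>F. B i)" using i F1 by blast
  qed
qed

end

section \<open>The group of assignments, its sections and projections\<close>

text \<open>The direct power of \<open>G\<close> over a whole index type; for \<open>nat\<close> its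
  elements are the assignments into \<open>G\<close>. Indexing by \<open>UNIV\<close> makes the
  extensionality condition on functions trivial.\<close>

definition fun_group :: "('a, 'b) monoid_scheme \<Rightarrow> ('i \<Rightarrow> 'a) monoid" where
  "fun_group G = product_group UNIV (\<lambda>_. G)"

lemma carrier_fun_group: "\<sigma> \<in> carrier (fun_group G) \<longleftrightarrow> (\<forall>i. \<sigma> i \<in> carrier G)"
  by (auto simp: fun_group_def)

lemma mult_fun_group: "\<sigma> \<otimes>\<^bsub>fun_group G\<^esub> \<tau> = (\<lambda>i. \<sigma> i \<otimes>\<^bsub>G\<^esub> \<tau> i)"
  by (simp add: fun_group_def fun_eq_iff)

lemma one_fun_group: "\<one>\<^bsub>fun_group G\<^esub> = (\<lambda>_. \<one>\<^bsub>G\<^esub>)"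
  by (simp add: fun_group_def fun_eq_iff)

definition coord_section ::
    "('a, 'b) monoid_scheme \<Rightarrow> 'i \<Rightarrow> ('i \<Rightarrow> 'a) \<Rightarrow> ('i \<Rightarrow> 'a) set \<Rightarrow> 'a set" where
  "coord_section G x \<sigma> H = {a \<in> carrier G. \<sigma>(x := a) \<in> H}"

text \<open>The semantic counterpart of an existential quantifier over a conjunction: one value of
  coordinate \<open>x\<close> serves all members of \<open>\<J>\<close> at once.\<close>

definition coord_projection ::
    "('a, 'b) monoid_scheme \<Rightarrow> 'i \<Rightarrow> ('i \<Rightarrow> 'a) set set \<Rightarrow> ('i \<Rightarrow> 'a) set" where
  "coord_projection G x \<J> =
    {\<sigma> \<in> carrier (fun_group G). \<exists>a\<in>carrier G. \<forall>H\<in>\<J>. \<sigma>(x := a) \<in> H}"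

context group
begin

lemma group_fun_group: "group (fun_group G)"
  by (simp add: fun_group_def)

lemma inv_fun_group:
  "\<sigma> \<in> carrier (fun_group G) \<Longrightarrow> inv\<^bsub>fun_group G\<^esub> \<sigma> = (\<lambda>i. inv \<sigma> i)"
  by (auto simp: fun_group_def)

lemma upd_mult:
  "(\<sigma>(x := a)) \<otimes>\<^bsub>fun_group G\<^esub> (\<tau>(x := b)) = (\<sigma> \<otimes>\<^bsub>fun_group G\<^esub> \<tau>)(x := a \<otimes> b)"
  by (auto simp: mult_fun_group)

lemma upd_inv:
  "\<sigma> \<in> carrier (fun_group G) \<Longrightarrow> a \<in> carrier G \<Longrightarrow>
    inv\<^bsub>fun_group G\<^esub> (\<sigma>(x := a)) = (inv\<^bsub>fun_group G\<^esub> \<sigma>)(x := inv a)"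
  by (subst (1 2) inv_fun_group) (auto simp: carrier_fun_group)

lemma upd_carrier:
  "\<sigma> \<in> carrier (fun_group G) \<Longrightarrow> a \<in> carrier G \<Longrightarrow> \<sigma>(x := a) \<in> carrier (fun_group G)"
  by (simp add: carrier_fun_group)

text \<open>Products and inverses of witnesses are witnesses for products and inverses of
  assignments.\<close>

lemma subgroup_coord_projection:
  assumes "\<And>H. H \<in> \<J> \<Longrightarrow> subgroup H (fun_group G)"
  shows "subgroup (coord_projection G x \<J>) (fun_group G)"
proof -
  interpret P: group "fun_group G" by (rule group_fun_group)
  show ?thesis
  proof (rule P.subgroupI)
    show "coord_projection G x \<J> \<subseteq> carrier (fun_group G)" by (auto simp: coord_projection_def)
    have "\<one>\<^bsub>fun_group G\<^esub>(x := \<one>) = \<one>\<^bsub>fun_group G\<^esub>" by (auto simp: one_fun_group)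
    then have "\<one>\<^bsub>fun_group G\<^esub> \<in> coord_projection G x \<J>"
      unfolding coord_projection_def
      by (auto intro!: bexI[of _ \<one>] subgroup.one_closed[OF assms])
    then show "coord_projection G x \<J> \<noteq> {}" by blast
  next
    fix \<sigma> assume "\<sigma> \<in> coord_projection G x \<J>"
    then obtain a where \<sigma>: "\<sigma> \<in> carrier (fun_group G)" and a: "a \<in> carrier G"
      "\<And>H. H \<in> \<J> \<Longrightarrow> \<sigma>(x := a) \<in> H" unfolding coord_projection_def by blast
    have "(inv\<^bsub>fun_group G\<^esub> \<sigma>)(x := inv a) \<in> H" if "H \<in> \<J>" for H
      using subgroup.m_inv_closed[OF assms a(2), OF that that] upd_inv[OF \<sigma> a(1)] by simp
    then show "inv\<^bsub>fun_group G\<^esub> \<sigma> \<in> coord_projection G x \<J>"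
      unfolding coord_projection_def using P.inv_closed[OF \<sigma>] inv_closed[OF a(1)] by blast
  next
    fix \<sigma> \<tau> assume "\<sigma> \<in> coord_projection G x \<J>" "\<tau> \<in> coord_projection G x \<J>"
    then obtain a b where \<sigma>: "\<sigma> \<in> carrier (fun_group G)" and a: "a \<in> carrier G"
      "\<And>H. H \<in> \<J> \<Longrightarrow> \<sigma>(x := a) \<in> H"
      and \<tau>: "\<tau> \<in> carrier (fun_group G)" and b: "b \<in> carrier G"
      "\<And>H. H \<in> \<J> \<Longrightarrow> \<tau>(x := b) \<in> H" unfolding coord_projection_def by blast
    have "(\<sigma> \<otimes>\<^bsub>fun_group G\<^esub> \<tau>)(x := a \<otimes> b) \<in> H" if "H \<in> \<J>" for H
      using subgroup.m_closed[OF assms a(2) b(2), OF that that that] upd_mult[of \<sigma> x a \<tau> b] by simp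
    then show "\<sigma> \<otimes>\<^bsub>fun_group G\<^esub> \<tau> \<in> coord_projection G x \<J>"
      unfolding coord_projection_def using P.m_closed[OF \<sigma> \<tau>] m_closed[OF a(1) b(1)] by blast
  qed
qed

text \<open>Dividing \<open>\<sigma>(x := y)\<close> by \<open>\<sigma>(x := a)\<close> cancels
  every coordinate except \<open>x\<close>, where \<open>y \<otimes> inv a\<close> remains.\<close>

lemma coord_section_diff:
  assumes H: "subgroup H (fun_group G)" and \<sigma>: "\<sigma> \<in> carrier (fun_group G)"
    and a: "a \<in> coord_section G x \<sigma> H" and y: "y \<in> carrier G"
  shows "y \<in> coord_section G x \<sigma> H \<longleftrightarrow> y \<otimes> inv a \<in> coord_section G x \<one>\<^bsub>fun_group G\<^esub> H"
proof -
  interpret P: group "fun_group G" by (rule group_fun_group)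
  have a': "a \<in> carrier G" "\<sigma>(x := a) \<in> H" using a by (auto simp: coord_section_def)
  have u: "\<sigma>(x := a) \<in> carrier (fun_group G)" "\<sigma>(x := y) \<in> carrier (fun_group G)"
    using upd_carrier[OF \<sigma>] a' y by auto
  have eq: "\<one>\<^bsub>fun_group G\<^esub>(x := y \<otimes> inv a)
      = (\<sigma>(x := y)) \<otimes>\<^bsub>fun_group G\<^esub> inv\<^bsub>fun_group G\<^esub> (\<sigma>(x := a))"
    using \<sigma> a' y by (simp add: upd_inv upd_mult)
  have "\<sigma>(x := y) \<in> H \<longleftrightarrow> (\<sigma>(x := y)) \<otimes>\<^bsub>fun_group G\<^esub> inv\<^bsub>fun_group G\<^esub> (\<sigma>(x := a)) \<in> H"
  proof
    assume "\<sigma>(x := y) \<in> H"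
    then show "(\<sigma>(x := y)) \<otimes>\<^bsub>fun_group G\<^esub> inv\<^bsub>fun_group G\<^esub> (\<sigma>(x := a)) \<in> H"
      using subgroup.m_closed[OF H] subgroup.m_inv_closed[OF H] a' by blast
  next
    assume "(\<sigma>(x := y)) \<otimes>\<^bsub>fun_group G\<^esub> inv\<^bsub>fun_group G\<^esub> (\<sigma>(x := a)) \<in> H"
    then have "(\<sigma>(x := y)) \<otimes>\<^bsub>fun_group G\<^esub> inv\<^bsub>fun_group G\<^esub> (\<sigma>(x := a))
        \<otimes>\<^bsub>fun_group G\<^esub> (\<sigma>(x := a)) \<in> H"
      using subgroup.m_closed[OF H] a' by blast
    then show "\<sigma>(x := y) \<in> H" using u by (simp add: P.m_assoc)
  qed
  then show ?thesis using eq a' y by (simp add: coord_section_def)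
qed

lemma partial_coset_coord_section:
  assumes "subgroup H (fun_group G)" "\<sigma> \<in> carrier (fun_group G)"
  shows "partial_coset G (coord_section G x \<one>\<^bsub>fun_group G\<^esub> H) (coord_section G x \<sigma> H)"
  unfolding partial_coset_def
  using coord_section_diff[OF assms] by (auto simp: coord_section_def)

lemma subgroup_coord_section:
  assumes H: "subgroup H (fun_group G)"
  shows "subgroup (coord_section G x \<one>\<^bsub>fun_group G\<^esub> H) G"
proof -
  interpret P: group "fun_group G" by (rule group_fun_group)
  have one: "\<one>\<^bsub>fun_group G\<^esub>(x := \<one>) = \<one>\<^bsub>fun_group G\<^esub>" by (auto simp: one_fun_group)
  show ?thesis
  proof (rule subgroupI)
    show "coord_section G x \<one>\<^bsub>fun_group G\<^esub> H \<subseteq> carrier G" by (auto simp: coord_section_def)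
    show "coord_section G x \<one>\<^bsub>fun_group G\<^esub> H \<noteq> {}"
      using subgroup.one_closed[OF H] one by (auto simp: coord_section_def)
  next
    fix a assume "a \<in> coord_section G x \<one>\<^bsub>fun_group G\<^esub> H"
    then have a: "a \<in> carrier G" "\<one>\<^bsub>fun_group G\<^esub>(x := a) \<in> H" by (auto simp: coord_section_def)
    then show "inv a \<in> coord_section G x \<one>\<^bsub>fun_group G\<^esub> H"
      using subgroup.m_inv_closed[OF H a(2)] by (simp add: coord_section_def upd_inv)
  next
    fix a b assume "a \<in> coord_section G x \<one>\<^bsub>fun_group G\<^esub> H" "b \<in> coord_section G x \<one>\<^bsub>fun_group G\<^esub> H"
    then have a: "a \<in> carrier G" "\<one>\<^bsub>fun_group G\<^esub>(x := a) \<in> H"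
      and b: "b \<in> carrier G" "\<one>\<^bsub>fun_group G\<^esub>(x := b) \<in> H" by (auto simp: coord_section_def)
    then show "a \<otimes> b \<in> coord_section G x \<one>\<^bsub>fun_group G\<^esub> H"
      using subgroup.m_closed[OF H a(2) b(2)] by (simp add: coord_section_def upd_mult)
  qed
qed

text \<open>The back-and-forth step that eliminates one existential quantifier.\<close>

lemma coord_projection_extension:
  assumes fin: "finite \<H>" and sub: "\<And>H. H \<in> \<H> \<Longrightarrow> subgroup H (fun_group G)"
    and \<sigma>: "\<sigma> \<in> carrier (fun_group G)" and \<tau>: "\<tau> \<in> carrier (fun_group G)"
    and agree: "\<And>\<J>. \<J> \<subseteq> \<H> \<Longrightarrow> \<sigma> \<in> coord_projection G x \<J> \<longleftrightarrow> \<tau> \<in> coord_projection G x \<J>"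
    and a: "a \<in> carrier G"
  obtains b where "b \<in> carrier G" "\<And>H. H \<in> \<H> \<Longrightarrow> \<sigma>(x := a) \<in> H \<longleftrightarrow> \<tau>(x := b) \<in> H"
proof -
  \<comment> \<open>The wanted \<open>b\<close> has to lie in the sections of \<open>\<tau>\<close>
    for \<open>I\<close> and avoid those for \<open>\<H> - I\<close>.\<close>
  define I where "I = {H \<in> \<H>. \<sigma>(x := a) \<in> H}"
  let ?S = "coord_section G x"
  let ?K = "?S \<one>\<^bsub>fun_group G\<^esub>"
  have I: "\<And>H. H \<in> I \<Longrightarrow> subgroup H (fun_group G)" using sub by (auto simp: I_def)
  have FI: "\<And>H. H \<in> \<H> - I \<Longrightarrow> subgroup H (fun_group G)" using sub by blast
  have carr: "partial_coset G (carrier G) (carrier G)" by (auto simp: partial_coset_def)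
  \<comment> \<open>This translates the emptiness pattern required by
    \<open>coset_cover_transfer\<close> into membership in projections, on which
    \<open>\<sigma>\<close> and \<open>\<tau>\<close> agree.\<close>
  have empty_iff: "carrier G \<inter> (\<Inter>H\<in>I. ?S \<rho> H) \<inter> (\<Inter>H\<in>J. ?S \<rho> H) = {}
      \<longleftrightarrow> \<rho> \<notin> coord_projection G x (I \<union> J)" if "\<rho> \<in> carrier (fun_group G)" for \<rho> J
    using that unfolding coord_projection_def coord_section_def by auto
  \<comment> \<open>Without a suitable \<open>b\<close> the sections of \<open>\<tau>\<close> would
    form a cover; it transfers to \<open>\<sigma>\<close>, where \<open>a\<close> refutes
    it.\<close>
  have "\<not> carrier G \<inter> (\<Inter>H\<in>I. ?S \<tau> H) \<subseteq> (\<Union>H\<in>\<H> - I. ?S \<tau> H)"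
  proof
    assume cover: "carrier G \<inter> (\<Inter>H\<in>I. ?S \<tau> H) \<subseteq> (\<Union>H\<in>\<H> - I. ?S \<tau> H)"
    have "carrier G \<inter> (\<Inter>H\<in>I. ?S \<sigma> H) \<subseteq> (\<Union>H\<in>\<H> - I. ?S \<sigma> H)"
    proof (rule coset_cover_transfer[where ?H0.0 = "carrier G \<inter> (\<Inter>H\<in>I. ?K H)" and H = ?K])
      show "finite (\<H> - I)" using fin by simp
      show "subgroup (carrier G \<inter> (\<Inter>H\<in>I. ?K H)) G"
        by (rule subgroup_Int_INT[OF subgroup_self subgroup_coord_section[OF I]])
      show "partial_coset G (carrier G \<inter> (\<Inter>H\<in>I. ?K H)) (carrier G \<inter> (\<Inter>H\<in>I. ?S \<tau> H))"
        by (rule partial_coset_Int_INT[OF carr partial_coset_coord_section[OF I \<tau>]])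
      show "partial_coset G (carrier G \<inter> (\<Inter>H\<in>I. ?K H)) (carrier G \<inter> (\<Inter>H\<in>I. ?S \<sigma> H))"
        by (rule partial_coset_Int_INT[OF carr partial_coset_coord_section[OF I \<sigma>]])
      show "carrier G \<inter> (\<Inter>H\<in>I. ?S \<tau> H) \<inter> (\<Inter>H\<in>J. ?S \<tau> H) = {}
          \<longleftrightarrow> carrier G \<inter> (\<Inter>H\<in>I. ?S \<sigma> H) \<inter> (\<Inter>H\<in>J. ?S \<sigma> H) = {}" if "J \<subseteq> \<H> - I" for J
        unfolding empty_iff[OF \<sigma>] empty_iff[OF \<tau>]
        by (subst agree) (use that in \<open>auto simp: I_def\<close>)
    qed (use cover FI \<sigma> \<tau> in \<open>auto intro!: subgroup_coord_section partial_coset_coord_section\<close>)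
    moreover have "a \<in> carrier G \<inter> (\<Inter>H\<in>I. ?S \<sigma> H)"
      using a by (auto simp: coord_section_def I_def)
    ultimately show False by (auto simp: coord_section_def I_def)
  qed
  then obtain b where b: "b \<in> carrier G" "\<And>H. H \<in> I \<Longrightarrow> b \<in> ?S \<tau> H"
      "\<And>H. H \<in> \<H> - I \<Longrightarrow> b \<notin> ?S \<tau> H" by blast
  show ?thesis
  proof (rule that[OF b(1)])
    show "\<sigma>(x := a) \<in> H \<longleftrightarrow> \<tau>(x := b) \<in> H" if "H \<in> \<H>" for H
      using b(2,3)[of H] b(1) that by (auto simp: coord_section_def I_def)
  qed
qed

end

section \<open>Terms and formulas in abelian groups\<close>

context comm_group
begin

lemma term_val_closed: "\<sigma> \<in> carrier (fun_group G) \<Longrightarrow> term_val G \<sigma> t \<in> carrier G"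
  by (induction t) (auto simp: carrier_fun_group)

text \<open>Commutativity lets factors be rearranged and inverses be distributed, so evaluating a
  fixed term is a homomorphism from the assignments to \<open>G\<close>.\<close>

lemma term_val_mult:
  "\<sigma> \<in> carrier (fun_group G) \<Longrightarrow> \<tau> \<in> carrier (fun_group G) \<Longrightarrow>
    term_val G (\<sigma> \<otimes>\<^bsub>fun_group G\<^esub> \<tau>) t = term_val G \<sigma> t \<otimes> term_val G \<tau> t"
  by (induction t) (simp_all add: mult_fun_group term_val_closed m_ac inv_mult)

text \<open>This is the equalizer of the two evaluation homomorphisms.\<close>

lemma subgroup_Eq:
  "subgroup {\<sigma> \<in> carrier (fun_group G). term_val G \<sigma> s = term_val G \<sigma> t} (fun_group G)"
proof -
  interpret P: group "fun_group G" by (rule group_fun_group)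
  have hom: "group_hom (fun_group G) G (\<lambda>\<sigma>. term_val G \<sigma> u)" for u
    by (intro group_hom.intro group_hom_axioms.intro homI)
      (simp_all add: group_fun_group group_axioms term_val_closed term_val_mult)
  show ?thesis
    by (rule P.subgroupI)
      (auto simp: term_val_mult group_hom.hom_inv[OF hom] group_hom.hom_one[OF hom]
        intro!: exI[of _ "\<one>\<^bsub>fun_group G\<^esub>"])
qed

text \<open>Induction on the formula: an equation contributes its solution subgroup, negation keeps
  the family, conjunction joins two families, and a quantifier replaces the family by the
  projections of all its subfamilies.\<close>

lemma sat_determined_by_subgroups:
  obtains \<H> where "finite \<H>" "\<And>H. H \<in> \<H> \<Longrightarrow> subgroup H (fun_group G)"
    "\<And>\<sigma> \<tau>. \<sigma> \<in> carrier (fun_group G) \<Longrightarrow> \<tau> \<in> carrier (fun_group G) \<Longrightarrow>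
      (\<And>H. H \<in> \<H> \<Longrightarrow> \<sigma> \<in> H \<longleftrightarrow> \<tau> \<in> H) \<Longrightarrow> sat G \<sigma> \<phi> \<longleftrightarrow> sat G \<tau> \<phi>"
proof (induction \<phi> arbitrary: thesis)
  case (Eq s t)
  show ?case
  proof (rule Eq)
    show "finite {{\<sigma> \<in> carrier (fun_group G). term_val G \<sigma> s = term_val G \<sigma> t}}" by simp
  qed (simp_all add: subgroup_Eq)
next
  case (Neg \<phi>)
  show ?case
  proof (rule Neg.IH)
    fix \<H> :: "(nat \<Rightarrow> 'a) set set"
    assume *: "finite \<H>" "\<And>H. H \<in> \<H> \<Longrightarrow> subgroup H (fun_group G)"
      "\<And>\<sigma> \<tau>. \<sigma> \<in> carrier (fun_group G) \<Longrightarrow> \<tau> \<in> carrier (fun_group G) \<Longrightarrow>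
        (\<And>H. H \<in> \<H> \<Longrightarrow> \<sigma> \<in> H \<longleftrightarrow> \<tau> \<in> H) \<Longrightarrow> sat G \<sigma> \<phi> \<longleftrightarrow> sat G \<tau> \<phi>"
    show ?case
    proof (rule Neg.prems[OF *(1,2)])
      show "sat G \<sigma> (Neg \<phi>) \<longleftrightarrow> sat G \<tau> (Neg \<phi>)"
        if "\<sigma> \<in> carrier (fun_group G)" "\<tau> \<in> carrier (fun_group G)"
          "\<And>H. H \<in> \<H> \<Longrightarrow> \<sigma> \<in> H \<longleftrightarrow> \<tau> \<in> H" for \<sigma> \<tau>
        using *(3)[OF that] by simp
    qed
  qed
next
  case (Conj \<phi> \<psi>)
  obtain \<H>1 where 1: "finite \<H>1" "\<And>H. H \<in> \<H>1 \<Longrightarrow> subgroup H (fun_group G)"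
    "\<And>\<sigma> \<tau>. \<sigma> \<in> carrier (fun_group G) \<Longrightarrow> \<tau> \<in> carrier (fun_group G) \<Longrightarrow>
      (\<And>H. H \<in> \<H>1 \<Longrightarrow> \<sigma> \<in> H \<longleftrightarrow> \<tau> \<in> H) \<Longrightarrow> sat G \<sigma> \<phi> \<longleftrightarrow> sat G \<tau> \<phi>"
    using Conj.IH(1) by blast
  obtain \<H>2 where 2: "finite \<H>2" "\<And>H. H \<in> \<H>2 \<Longrightarrow> subgroup H (fun_group G)"
    "\<And>\<sigma> \<tau>. \<sigma> \<in> carrier (fun_group G) \<Longrightarrow> \<tau> \<in> carrier (fun_group G) \<Longrightarrow>
      (\<And>H. H \<in> \<H>2 \<Longrightarrow> \<sigma> \<in> H \<longleftrightarrow> \<tau> \<in> H) \<Longrightarrow> sat G \<sigma> \<psi> \<longleftrightarrow> sat G \<tau> \<psi>"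
    using Conj.IH(2) by blast
  show ?case
  proof (rule Conj.prems)
    show "finite (\<H>1 \<union> \<H>2)" using 1(1) 2(1) by simp
    show "subgroup H (fun_group G)" if "H \<in> \<H>1 \<union> \<H>2" for H using that 1(2) 2(2) by blast
    show "sat G \<sigma> (Conj \<phi> \<psi>) \<longleftrightarrow> sat G \<tau> (Conj \<phi> \<psi>)"
      if "\<sigma> \<in> carrier (fun_group G)" "\<tau> \<in> carrier (fun_group G)"
        "\<And>H. H \<in> \<H>1 \<union> \<H>2 \<Longrightarrow> \<sigma> \<in> H \<longleftrightarrow> \<tau> \<in> H" for \<sigma> \<tau>
      using 1(3)[OF that(1,2)] 2(3)[OF that(1,2)] that(3) by simp
  qed
next
  case (Ex x \<phi>)
  obtain \<H> where \<H>: "finite \<H>" "\<And>H. H \<in> \<H> \<Longrightarrow> subgroup H (fun_group G)"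
    "\<And>\<sigma> \<tau>. \<sigma> \<in> carrier (fun_group G) \<Longrightarrow> \<tau> \<in> carrier (fun_group G) \<Longrightarrow>
      (\<And>H. H \<in> \<H> \<Longrightarrow> \<sigma> \<in> H \<longleftrightarrow> \<tau> \<in> H) \<Longrightarrow> sat G \<sigma> \<phi> \<longleftrightarrow> sat G \<tau> \<phi>"
    using Ex.IH by blast
  \<comment> \<open>One implication suffices, since agreement of \<open>\<sigma>\<close> and
    \<open>\<tau>\<close> is symmetric.\<close>
  have imp: "sat G \<tau> (Ex x \<phi>)"
    if \<sigma>: "\<sigma> \<in> carrier (fun_group G)" and \<tau>: "\<tau> \<in> carrier (fun_group G)"
      and agree: "\<And>\<J>. \<J> \<subseteq> \<H> \<Longrightarrow> \<sigma> \<in> coord_projection G x \<J> \<longleftrightarrow> \<tau> \<in> coord_projection G x \<J>"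
      and sat: "sat G \<sigma> (Ex x \<phi>)" for \<sigma> \<tau>
  proof -
    from sat obtain a where a: "a \<in> carrier G" "sat G (\<sigma>(x := a)) \<phi>" by auto
    obtain b where b: "b \<in> carrier G" "\<And>H. H \<in> \<H> \<Longrightarrow> \<sigma>(x := a) \<in> H \<longleftrightarrow> \<tau>(x := b) \<in> H"
      using coord_projection_extension[OF \<H>(1,2) \<sigma> \<tau> agree a(1)] by blast
    have "sat G (\<tau>(x := b)) \<phi>"
      using \<H>(3)[OF upd_carrier[OF \<sigma> a(1)] upd_carrier[OF \<tau> b(1)] b(2)] a(2) by simp
    then show ?thesis using b(1) by auto
  qed
  show ?case
  proof (rule Ex.prems)
    show "finite (coord_projection G x ` Pow \<H>)" using \<H>(1) by simp
    show "subgroup H (fun_group G)" if "H \<in> coord_projection G x ` Pow \<H>" for H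
    proof -
      from that obtain \<J> where \<J>: "H = coord_projection G x \<J>" "\<J> \<in> Pow \<H>" by (rule imageE)
      show ?thesis
        unfolding \<J>(1)
        by (rule subgroup_coord_projection, rule \<H>(2), rule subsetD[OF PowD[OF \<J>(2)]])
    qed
    show "sat G \<sigma> (Ex x \<phi>) \<longleftrightarrow> sat G \<tau> (Ex x \<phi>)"
      if \<sigma>\<tau>: "\<sigma> \<in> carrier (fun_group G)" "\<tau> \<in> carrier (fun_group G)"
        and agree: "\<And>H. H \<in> coord_projection G x ` Pow \<H> \<Longrightarrow> \<sigma> \<in> H \<longleftrightarrow> \<tau> \<in> H" for \<sigma> \<tau>
    proof -
      have "\<sigma> \<in> coord_projection G x \<J> \<longleftrightarrow> \<tau> \<in> coord_projection G x \<J>" if "\<J> \<subseteq> \<H>" for \<J>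
        using that by (intro agree imageI PowI)
      then show ?thesis 
        using imp[OF \<sigma>\<tau>] imp[OF \<sigma>\<tau>(2,1)] by (intro iffI) simp_all
    qed
  qed
qed

section \<open>Torsion and finiteness\<close>

text \<open>A subgroup containing a positive power of \<open>g\<close> contains \<open>g [^] m\<close> for a common
  exponent \<open>m > 0\<close>, and any other contains neither \<open>g\<close> nor \<open>g [^] (1 + m * k)\<close>. Hence
  \<open>g\<close> and all \<open>g [^] (1 + m * k)\<close> satisfy the same formula.\<close>

lemma def_set_torsion:
  assumes fin: "finite (def_set G \<phi>)" and g: "g \<in> def_set G \<phi>"
  shows "\<exists>n::nat. n \<noteq> 0 \<and> g [^] n = \<one>"
proof -
  obtain \<H> where \<H>: "finite \<H>" "\<And>H. H \<in> \<H> \<Longrightarrow> subgroup H (fun_group G)"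
    "\<And>\<sigma> \<tau>. \<sigma> \<in> carrier (fun_group G) \<Longrightarrow> \<tau> \<in> carrier (fun_group G) \<Longrightarrow>
      (\<And>H. H \<in> \<H> \<Longrightarrow> \<sigma> \<in> H \<longleftrightarrow> \<tau> \<in> H) \<Longrightarrow> sat G \<sigma> \<phi> \<longleftrightarrow> sat G \<tau> \<phi>"
    using sat_determined_by_subgroups[of \<phi>] by blast
  interpret P: group "fun_group G :: (nat \<Rightarrow> 'a) monoid" by (rule group_fun_group)
  have gc: "g \<in> carrier G" and gsat: "sat G (\<lambda>_. g) \<phi>" using g by (auto simp: def_set_def)
  define c :: "nat \<Rightarrow> 'a" where "c = (\<lambda>_. g)"
  have c: "c \<in> carrier (fun_group G)" using gc by (simp add: c_def carrier_fun_group)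
  \<comment> \<open>Powers of a constant assignment stay constant, so satisfaction at such a power
    speaks about a power of \<open>g\<close>.\<close>
  have pow: "c [^]\<^bsub>fun_group G\<^esub> n = (\<lambda>_. g [^] n)" for n :: nat
    by (induction n) (simp_all add: one_fun_group mult_fun_group c_def)
  \<comment> \<open>\<open>n H\<close> is a positive exponent that brings \<open>c\<close> into
    \<open>H\<close> if one exists, and any positive number otherwise. The product \<open>m\<close>
    is then a common multiple.\<close>
  have "\<forall>H. \<exists>n::nat. n \<noteq> 0 \<and>
      ((\<exists>n::nat. n \<noteq> 0 \<and> c [^]\<^bsub>fun_group G\<^esub> n \<in> H) \<longrightarrow> c [^]\<^bsub>fun_group G\<^esub> n \<in> H)"
    by (meson one_neq_zero)
  then obtain n :: "(nat \<Rightarrow> 'a) set \<Rightarrow> nat" where n: "\<And>H. n H \<noteq> 0 \<and>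
      ((\<exists>n::nat. n \<noteq> 0 \<and> c [^]\<^bsub>fun_group G\<^esub> n \<in> H) \<longrightarrow> c [^]\<^bsub>fun_group G\<^esub> n H \<in> H)"
    by (auto dest!: choice)
  define m where "m = (\<Prod>H\<in>\<H>. n H)"
  have m: "m \<noteq> 0" using \<H>(1) n by (simp add: m_def)
  have agree: "c [^]\<^bsub>fun_group G\<^esub> (1 + m * k) \<in> H \<longleftrightarrow> c \<in> H" if H: "H \<in> \<H>" for H k
  proof (cases "\<exists>n::nat. n \<noteq> 0 \<and> c [^]\<^bsub>fun_group G\<^esub> n \<in> H")
    case True
    obtain q where q: "m = n H * q"
      using dvd_prodI[OF \<H>(1) H, of n] by (auto simp: m_def dvd_def)
    have nH: "c [^]\<^bsub>fun_group G\<^esub> n H \<in> H" using n[of H] True by blast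
    have "(c [^]\<^bsub>fun_group G\<^esub> n H) [^]\<^bsub>fun_group G\<^esub> r \<in> H" for r :: nat
      by (induction r)
        (simp_all add: nH subgroup.one_closed[OF \<H>(2)[OF H]] subgroup.m_closed[OF \<H>(2)[OF H]])
    then have "(c [^]\<^bsub>fun_group G\<^esub> n H) [^]\<^bsub>fun_group G\<^esub> (q * k) \<in> H" .
    then have h: "c [^]\<^bsub>fun_group G\<^esub> (m * k) \<in> H"
      using c by (simp add: P.nat_pow_pow q mult.assoc)
    have e: "c [^]\<^bsub>fun_group G\<^esub> (1 + m * k) = c \<otimes>\<^bsub>fun_group G\<^esub> c [^]\<^bsub>fun_group G\<^esub> (m * k)"
      using c P.nat_pow_mult[OF c, of 1 "m * k"] by simp
    have hc: "c [^]\<^bsub>fun_group G\<^esub> (m * k) \<in> carrier (fun_group G)" using c by simp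
    show ?thesis
    proof
      assume "c \<in> H"
      then show "c [^]\<^bsub>fun_group G\<^esub> (1 + m * k) \<in> H"
        unfolding e using h subgroup.m_closed[OF \<H>(2)[OF H]] by blast
    next
      assume "c [^]\<^bsub>fun_group G\<^esub> (1 + m * k) \<in> H"
      then have "c \<otimes>\<^bsub>fun_group G\<^esub> c [^]\<^bsub>fun_group G\<^esub> (m * k) \<otimes>\<^bsub>fun_group G\<^esub>
          inv\<^bsub>fun_group G\<^esub> (c [^]\<^bsub>fun_group G\<^esub> (m * k)) \<in> H"
        unfolding e using h subgroup.m_closed[OF \<H>(2)[OF H]] subgroup.m_inv_closed[OF \<H>(2)[OF H]]
        by blast
      then show "c \<in> H" using c hc by (simp add: P.m_assoc)
    qed
  next
    case False
    have "c [^]\<^bsub>fun_group G\<^esub> (1::nat) = c" using c by simp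
    then have "c \<notin> H" using False by (metis one_neq_zero)
    moreover have "c [^]\<^bsub>fun_group G\<^esub> (1 + m * k) \<notin> H"
      using False by (metis add_is_0 one_neq_zero)
    ultimately show ?thesis by simp
  qed
  have mem: "g [^] (1 + m * k) \<in> def_set G \<phi>" for k
  proof -
    have "sat G (c [^]\<^bsub>fun_group G\<^esub> (1 + m * k)) \<phi> \<longleftrightarrow> sat G c \<phi>"
      by (rule \<H>(3)[OF P.nat_pow_closed[OF c] c agree])
    then have "sat G (\<lambda>_. g [^] (1 + m * k)) \<phi>"
      using gsat unfolding c_def[symmetric] pow by blast
    then show ?thesis using gc by (simp add: def_set_def)
  qed
  \<comment> \<open>The exponents \<open>1 + m * k\<close> are pairwise distinct as \<open>m\<close>
    is nonzero, so finiteness of the definable set makes two different powers of \<open>g\<close>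
    coincide.\<close>
  have "\<not> inj (\<lambda>k. g [^] (1 + m * k))"
  proof
    assume "inj (\<lambda>k. g [^] (1 + m * k))"
    then have "infinite (range (\<lambda>k. g [^] (1 + m * k)))" by (rule range_inj_infinite)
    moreover have "range (\<lambda>k. g [^] (1 + m * k)) \<subseteq> def_set G \<phi>" using mem by blast
    ultimately show False using fin finite_subset by blast
  qed
  then obtain j k where "g [^] (1 + m * j) = g [^] (1 + m * k)" "j \<noteq> k" by (auto simp: inj_def)
  moreover have "1 + m * j \<noteq> 1 + m * k" using \<open>j \<noteq> k\<close> m by simp
  ultimately have "\<not> (\<forall>i j::nat. g [^] i = g [^] j \<longrightarrow> i = j)" by blast
  then show ?thesis using infinite_cyclic_subgroup[OF gc] finite_cyclic_subgroup[OF gc] by blast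
qed

text \<open>Adjoining a generator multiplies a finite subgroup by a finite cyclic one, and in an
  abelian group this product is again a finite subgroup.\<close>

lemma finite_generate_torsion:
  assumes "finite S" "S \<subseteq> carrier G" "\<And>g. g \<in> S \<Longrightarrow> \<exists>n::nat. n \<noteq> 0 \<and> g [^] n = \<one>"
  shows "finite (generate G S)"
proof -
  have "\<exists>K. subgroup K G \<and> finite K \<and> S \<subseteq> K"
    using assms
  proof (induction S rule: finite_induct)
    case empty
    then show ?case using triv_subgroup by blast
  next
    case (insert g S)
    then obtain K where K: "subgroup K G" "finite K" "S \<subseteq> K" by auto
    let ?C = "carrier (subgroup_generated G {g})"
    have g: "g \<in> carrier G" using insert.prems by auto
    have C: "subgroup ?C G" by (rule subgroup_subgroup_generated)
    have "finite ?C" using finite_cyclic_subgroup[OF g] insert.prems(2) by blast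
    moreover have "K <#> ?C = (\<lambda>(x, y). x \<otimes> y) ` (K \<times> ?C)" by (auto simp: set_mult_def)
    ultimately have "finite (K <#> ?C)" using K(2) by simp
    moreover have "subgroup (K <#> ?C) G" using mult_subgroups[OF K(1) C] .
    moreover have "insert g S \<subseteq> K <#> ?C"
    proof
      have gC: "g \<in> ?C" using g by (simp add: carrier_subgroup_generated generate.incl)
      fix h assume "h \<in> insert g S"
      then show "h \<in> K <#> ?C"
      proof
        assume "h = g"
        then have "h = \<one> \<otimes> g" using g by simp
        then show ?thesis using subgroup.one_closed[OF K(1)] gC unfolding set_mult_def by blast
      next
        assume "h \<in> S"
        then have "h = h \<otimes> \<one>" "h \<in> K" using insert.prems(1) K(3) by auto
        then show ?thesis using subgroup.one_closed[OF C] unfolding set_mult_def by blast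
      qed
    qed
    ultimately show ?case by blast
  qed
  then show ?thesis using generate_subgroup_incl finite_subset by metis
qed

end

theorem theorem1p1:
  fixes \<phi> :: gformula
  assumes "one_free_var \<phi>"
  shows "concise_in \<phi> {G :: ('a, 'b) monoid_scheme. comm_group G}"
  unfolding concise_in_def
proof (intro ballI impI)
  fix G :: "('a, 'b) monoid_scheme"
  assume G: "G \<in> {G. comm_group G}" and fin: "finite (def_set G \<phi>)"
  interpret comm_group G using G by simp
  have "def_set G \<phi> \<subseteq> carrier G" by (auto simp: def_set_def)
  then show "finite (def_subgroup G \<phi>)"
    unfolding def_subgroup_def
    using fin def_set_torsion[OF fin] by (intro finite_generate_torsion)
qed

end
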